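(* Let $\alpha\in(0,1)$ and let $k\ge 2$ be an integer. For every $k$-Fourier-sparse function $f:\{0,1\}^n\to\{-1,1\}$ that satisfies $\widehat f(0^n)=1-2\alpha$ and has Fourier dimension $r$, we have $$\widehat f(0^n)\le 1-\frac{r}{k\log k}.$$
   Context: Logarithms are base 2. For $f:\{0,1\}^n\to\mathbb{R}$ and $S\in\{0,1\}^n$, the Fourier coefficient is $\widehat f(S)=2^{-n}\sum_{x\in\{0,1\}^n} f(x)(-1)^{S\cdot x}$. The Fourier support of $f$ is $\mathrm{supp}(\widehat f)=\{S\in\{0,1\}^n:\widehat f(S)\ne 0\}$; $f$ is $k$-Fourier-sparse if $|\mathrm{supp}(\widehat f)|\le k$. The Fourier dimension of $f$ is the dimension over $\mathbb{F}_2$ of the linear span of $\mathrm{supp}(\widehat f)$ in $\mathbb{F}_2^n=\{0,1\}^n$. *)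

theory Defs
  imports "HOL-Analysis.Analysis" "HOL-Library.Z2"
begin

text \<open>
  The cube is the \<open>\<bbbF>\<^sub>2\<close>-vector space \<^typ>\<open>bit ^ 'n\<close> with \<^typ>\<open>'n\<close> the set of coordinates.
  The instance makes it a finite type, so that sums and cardinalities over it are genuine
  (for infinite sets both would be 0 by convention).
\<close>

instance bit :: finite
proof
  have "(UNIV :: bit set) = {0, 1}"
    using bit_not_zero_iff by blast
  then show "finite (UNIV :: bit set)"
    by (metis finite.emptyI finite.insertI)
qed

definition bit_dot :: "bit ^ 'n \<Rightarrow> bit ^ 'n \<Rightarrow> bit" where
  "bit_dot S x = (\<Sum>i\<in>UNIV. S $ i * x $ i)"

text \<open>
  The sign \<open>(-1)\<close> to the power \<open>S \<cdot> x\<close> depends only on the parity of the exponent, so the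
  dot product is taken modulo 2.
\<close>

definition fourier_character :: "bit ^ 'n \<Rightarrow> bit ^ 'n \<Rightarrow> real" where
  "fourier_character S x = (if bit_dot S x = 0 then 1 else - 1)"

definition fourier_coeff :: "(bit ^ 'n \<Rightarrow> real) \<Rightarrow> bit ^ 'n \<Rightarrow> real" where
  "fourier_coeff f S = (\<Sum>x\<in>UNIV. f x * fourier_character S x) / 2 ^ CARD('n)"

definition fourier_support :: "(bit ^ 'n \<Rightarrow> real) \<Rightarrow> (bit ^ 'n) set" where
  "fourier_support f = {S. fourier_coeff f S \<noteq> 0}"

definition fourier_sparse :: "nat \<Rightarrow> (bit ^ 'n \<Rightarrow> real) \<Rightarrow> bool" where
  "fourier_sparse k f \<longleftrightarrow> card (fourier_support f) \<le> k"

text \<open>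
  \<^term>\<open>vec.span\<close> and \<^term>\<open>vec.dim\<close> are span and dimension over the scalar field of the
  components, here \<^typ>\<open>bit\<close>.
\<close>

definition fourier_dim :: "(bit ^ 'n \<Rightarrow> real) \<Rightarrow> nat" where
  "fourier_dim f = vec.dim (vec.span (fourier_support f))"

end

theory Submission
  imports Defs
begin

text \<open>
  The translates of \<open>f\<close> span a space of dimension \<open>m = |supp f|\<close>, so there are at most \<open>m\<close>
  points \<open>Y\<close> such that the pattern \<open>(f (x + y))\<close>, \<open>y \<in> Y\<close>, determines the whole translate of
  \<open>f\<close> by \<open>x\<close>, hence determines \<open>x\<close> modulo the annihilator of the Fourier support, which has
  codimension \<open>r\<close>. For uniform \<open>x\<close> the pattern therefore has entropy at least \<open>r\<close>; each of its
  entries is \<open>-1\<close> with probability \<open>\<alpha>\<close>, so subadditivity gives \<open>r \<le> m H(\<alpha>) \<le> k H(\<alpha>)\<close>. Finally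
  the uncertainty bound \<open>\<alpha> k \<ge> 1\<close> gives \<open>H(\<alpha>) \<le> 2 \<alpha> log k\<close>.
\<close>

section \<open>Characters and Fourier inversion on the cube\<close>

lemma real_card_cube: "real CARD(bit ^ 'n) = 2 ^ CARD('n)"
proof -
  have "(UNIV :: bit set) = {0, 1}"
    using bit_not_zero_iff by blast
  then have "CARD(bit) = 2"
    by (metis card_2_iff zero_neq_one)
  then show ?thesis
    by simp
qed

lemma cube_add_self [simp]: "x + x = (0 :: bit ^ 'n)"
  by (simp add: vec_eq_iff)

lemma cube_uminus [simp]: "- x = (x :: bit ^ 'n)"
  by (metis cube_add_self minus_unique)

lemma bit_dot_commute: "bit_dot S x = bit_dot x S"
  unfolding bit_dot_def by (simp only: mult.commute)

lemma bit_dot_add_right: "bit_dot S (x + y) = bit_dot S x + bit_dot S y"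
  unfolding bit_dot_def vector_add_component distrib_left sum.distrib ..

lemma fourier_character_commute: "fourier_character S x = fourier_character x S"
  unfolding fourier_character_def by (simp only: bit_dot_commute)

lemma fourier_character_add_right:
  "fourier_character S (x + y) = fourier_character S x * fourier_character S y"
  unfolding fourier_character_def bit_dot_add_right
  by (cases "bit_dot S x"; cases "bit_dot S y") auto

lemma fourier_character_add_left:
  "fourier_character (S + T) x = fourier_character S x * fourier_character T x"
  by (metis fourier_character_add_right fourier_character_commute)

lemma fourier_character_zero_left [simp]: "fourier_character 0 x = 1"
  by (simp add: fourier_character_def bit_dot_def)

lemma fourier_character_cases: "fourier_character S x = 1 \<or> fourier_character S x = - 1"
  by (simp add: fourier_character_def)

lemma fourier_character_sum_left:
  "fourier_character (\<Sum>S\<in>A. S) x = (\<Prod>S\<in>A. fourier_character S x)"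
  by (induction A rule: infinite_finite_induct) (simp_all add: fourier_character_add_left)

lemma sum_translate: "(\<Sum>x\<in>UNIV. h (x + a)) = (\<Sum>x\<in>UNIV. h x)" for a :: "bit ^ 'n"
  by (rule sum.reindex_bij_witness[of _ "\<lambda>x. x + a" "\<lambda>x. x + a"]) (simp_all add: add.assoc)

text \<open>Translation by a unit vector at a coordinate where \<open>S\<close> is 1 flips the sign
  of the character, so for nonzero \<open>S\<close> the sum equals its own negative.\<close>

lemma sum_fourier_character:
  "(\<Sum>x\<in>UNIV. fourier_character S x) = (if S = 0 then 2 ^ CARD('n) else 0)"
  for S :: "bit ^ 'n"
proof (cases "S = 0")
  case True
  then show ?thesis
    using real_card_cube[where 'n = 'n] by simp
next
  case False
  then obtain i where i: "S $ i = 1"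
    by (auto simp: vec_eq_iff)
  have "bit_dot S (axis i 1) = (\<Sum>j\<in>UNIV. if j = i then 1 else 0)"
    unfolding bit_dot_def axis_def by (rule sum.cong) (use i in auto)
  then have "fourier_character S (axis i 1) = - 1"
    by (simp add: fourier_character_def)
  then have "(\<Sum>x\<in>UNIV. fourier_character S x) = - (\<Sum>x\<in>UNIV. fourier_character S x)"
    using sum_translate[of "fourier_character S" "axis i 1"]
    by (simp add: fourier_character_add_right sum_negf)
  with False show ?thesis
    by simp
qed

lemma fourier_inversion:
  "f x = (\<Sum>S\<in>fourier_support f. fourier_coeff f S * fourier_character S x)"
  for f :: "bit ^ 'n \<Rightarrow> real"
proof -
  have "(\<Sum>S\<in>fourier_support f. fourier_coeff f S * fourier_character S x) =
      (\<Sum>S\<in>UNIV. fourier_coeff f S * fourier_character S x)"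
    by (rule sum.mono_neutral_left) (auto simp: fourier_support_def)
  also have "\<dots> = (\<Sum>S\<in>UNIV. \<Sum>z\<in>UNIV. f z * fourier_character (z + x) S / 2 ^ CARD('n))"
    unfolding fourier_coeff_def sum_divide_distrib sum_distrib_right
    by (intro sum.cong refl)
      (simp add: fourier_character_commute[of "_ + _"] fourier_character_add_right)
  also have "\<dots> = (\<Sum>z\<in>UNIV. f z * (\<Sum>S\<in>UNIV. fourier_character (z + x) S) / 2 ^ CARD('n))"
    unfolding sum_distrib_left sum_divide_distrib by (rule sum.swap)
  also have "\<dots> = (\<Sum>z\<in>UNIV. if z = x then f z else 0)"
    by (intro sum.cong refl) (auto simp: sum_fourier_character add_eq_0_iff)
  also have "\<dots> = f x"
    by simp
  finally show ?thesis ..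
qed

lemma sum_eq_fourier_coeff_zero: "(\<Sum>x\<in>UNIV. f x) = fourier_coeff f 0 * 2 ^ CARD('n)"
  for f :: "bit ^ 'n \<Rightarrow> real"
  by (simp add: fourier_coeff_def)

lemma fourier_coeff_translate:
  "fourier_coeff (\<lambda>y. f (x + y)) S = fourier_character S x * fourier_coeff f S"
proof -
  have "(\<Sum>y\<in>UNIV. f (x + y) * fourier_character S y) =
      (\<Sum>y\<in>UNIV. f (x + (y + x)) * fourier_character S (y + x))"
    by (rule sum_translate[symmetric])
  also have "\<dots> = (\<Sum>y\<in>UNIV. fourier_character S x * (f y * fourier_character S y))"
    by (intro sum.cong refl)
      (simp add: fourier_character_add_right add.left_commute[of x _ x])
  finally show ?thesis
    by (simp add: fourier_coeff_def sum_distrib_left)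
qed

section \<open>Interpolation points and annihilators\<close>

text \<open>A space spanned by \<open>card A\<close> functions is determined by that many evaluation
  points. In the induction a point is added only if \<open>e a\<close> agrees on \<open>Y\<close>
  with a combination of the earlier functions without being equal to it.\<close>

lemma interpolation_set:
  fixes e :: "'s \<Rightarrow> 'a \<Rightarrow> real"
  assumes "finite A"
  shows "\<exists>Y. finite Y \<and> card Y \<le> card A \<and>
    (\<forall>c. (\<forall>y\<in>Y. (\<Sum>s\<in>A. c s * e s y) = 0) \<longrightarrow> (\<forall>x. (\<Sum>s\<in>A. c s * e s x) = 0))"
  using assms
proof (induction A rule: finite_induct)
  case empty
  show ?case by (rule exI[of _ "{}"]) simp
next
  case (insert a A)
  then obtain Y where Y: "finite Y" "card Y \<le> card A"
    and det: "\<And>c x. \<forall>y\<in>Y. (\<Sum>s\<in>A. c s * e s y) = 0 \<Longrightarrow> (\<Sum>s\<in>A. c s * e s x) = 0"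
    by blast
  show ?case
  proof (cases "\<exists>c p. (\<forall>y\<in>Y. e a y = (\<Sum>s\<in>A. c s * e s y)) \<and> e a p \<noteq> (\<Sum>s\<in>A. c s * e s p)")
    case True
    then obtain c p where c: "\<And>y. y \<in> Y \<Longrightarrow> e a y = (\<Sum>s\<in>A. c s * e s y)"
      and p: "e a p \<noteq> (\<Sum>s\<in>A. c s * e s p)"
      by blast
    have "(\<Sum>s\<in>insert a A. d s * e s x) = 0"
      if d: "\<forall>y\<in>insert p Y. (\<Sum>s\<in>insert a A. d s * e s y) = 0" for d x
    proof -
      \<comment> \<open>Replacing \<open>e a\<close> by the combination \<open>c\<close> changes
        nothing on \<open>Y\<close>, so \<open>det\<close> applies to the new coefficients; at
        \<open>p\<close> the nonzero correction then forces \<open>d a = 0\<close>.\<close>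
      have eq: "(\<Sum>s\<in>A. (d s + d a * c s) * e s y) =
          (\<Sum>s\<in>insert a A. d s * e s y) - d a * (e a y - (\<Sum>s\<in>A. c s * e s y))" for y
        using insert.hyps by (simp add: algebra_simps sum.distrib sum_distrib_left)
      have van: "(\<Sum>s\<in>A. (d s + d a * c s) * e s z) = 0" for z
        by (rule det) (use d c in \<open>simp add: eq\<close>)
      have "d a = 0"
        using van[of p] eq[of p] d p by simp
      then show ?thesis
        using van[of x] eq[of x] by simp
    qed
    moreover have "card (insert p Y) \<le> card (insert a A)"
      using insert.hyps Y card_insert_le_m1[of "card (insert a A)" Y p] by simp
    ultimately show ?thesis
      using Y by (intro exI[of _ "insert p Y"]) blast
  next
    case False
    have "(\<Sum>s\<in>insert a A. d s * e s x) = 0"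
      if d: "\<forall>y\<in>Y. (\<Sum>s\<in>insert a A. d s * e s y) = 0" for d x
    proof (cases "d a = 0")
      case True
      then show ?thesis
        using d insert.hyps det[of d x] by simp
    next
      case nz: False
      \<comment> \<open>Dividing by \<open>d a\<close> expresses \<open>e a\<close> on
        \<open>Y\<close> through the earlier functions; in this case such an expression holds at
        every point.\<close>
      have eq: "(\<Sum>s\<in>A. - d s / d a * e s y) = - (\<Sum>s\<in>A. d s * e s y) / d a" for y
        by (simp add: sum_negf sum_divide_distrib)
      have iff: "e a y = (\<Sum>s\<in>A. - d s / d a * e s y) \<longleftrightarrow> (\<Sum>s\<in>insert a A. d s * e s y) = 0" for y
        unfolding eq using insert.hyps nz by (auto simp: field_simps)
      with d have "\<forall>y\<in>Y. e a y = (\<Sum>s\<in>A. - d s / d a * e s y)"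
        by blast
      with False have "e a x = (\<Sum>s\<in>A. - d s / d a * e s x)"
        by (auto dest: spec[where x = "\<lambda>s. - d s / d a"])
      then show ?thesis
        using iff by blast
    qed
    with Y insert.hyps show ?thesis
      by (intro exI[of _ Y]) auto
  qed
qed

text \<open>The product of \<open>fourier_character S z + 1\<close> over \<open>B\<close> is
  \<open>2 ^ card B\<close> on the annihilator and 0 elsewhere. Expanded over subsets of
  \<open>B\<close> and summed over \<open>z\<close>, only the empty subset survives, because by
  independence no other subset sums to 0.\<close>

lemma card_annihilator:
  fixes B :: "(bit ^ 'n) set"
  assumes "vec.independent B"
  shows "real (card {z. \<forall>S\<in>B. fourier_character S z = 1}) * 2 ^ card B = 2 ^ CARD('n)"
proof -
  have fin: "finite B"
    by simp
  have indep: "(\<Sum>S\<in>A. S) = 0 \<longleftrightarrow> A = {}" if "A \<subseteq> B" for A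
  proof
    assume "(\<Sum>S\<in>A. S) = 0"
    then have "(\<Sum>S\<in>A. 1 *s S) = 0"
      by simp
    moreover have "\<forall>u. (\<Sum>S\<in>A. u S *s S) = 0 \<longrightarrow> (\<forall>S\<in>A. u S = 0)"
      using assms that unfolding vec.independent_explicit_finite_subsets by simp
    ultimately have "\<forall>S\<in>A. (1 :: bit) = 0"
      by (elim allE[of _ "\<lambda>_. 1"]) (rule mp)
    then show "A = {}"
      by auto
  qed simp
  have prod: "(\<Prod>S\<in>B. fourier_character S z + 1) =
      (if \<forall>S\<in>B. fourier_character S z = 1 then 2 ^ card B else 0)" for z
  proof (cases "\<forall>S\<in>B. fourier_character S z = 1")
    case False
    then obtain S where "S \<in> B" "fourier_character S z + 1 = 0"
      using fourier_character_cases by fastforce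
    with False show ?thesis
      using fin by (auto intro!: prod_zero)
  qed simp
  have "(\<Sum>z\<in>UNIV. \<Prod>S\<in>B. fourier_character S z + 1) =
      (\<Sum>z\<in>UNIV. \<Sum>A\<in>Pow B. fourier_character (\<Sum>S\<in>A. S) z)"
    by (simp add: prod_add[OF fin] fourier_character_sum_left)
  also have "\<dots> = (\<Sum>A\<in>Pow B. \<Sum>z\<in>UNIV. fourier_character (\<Sum>S\<in>A. S) z)"
    by (rule sum.swap)
  also have "\<dots> = (\<Sum>A\<in>Pow B. if A = {} then 2 ^ CARD('n) else 0)"
    by (intro sum.cong refl) (use indep in \<open>auto simp: sum_fourier_character\<close>)
  also have "\<dots> = 2 ^ CARD('n)"
    by simp
  finally show ?thesis
    by (simp add: prod sum.If_cases)
qed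

text \<open>Translation by \<open>x\<close> multiplies the coefficient at \<open>S\<close> by the
  character value at \<open>x\<close>, and on the support this coefficient can be cancelled.\<close>

lemma fourier_character_eq_if_translates_eq:
  assumes "\<And>y. f (x + y) = f (x' + y)" and "S \<in> fourier_support f"
  shows "fourier_character S x = fourier_character S x'"
  using assms fourier_coeff_translate[of f x S] fourier_coeff_translate[of f x' S]
  by (simp add: fourier_support_def)

section \<open>Estimates for the binary entropy in natural logarithms\<close>

lemma binary_entropy_nonneg:
  fixes \<alpha> :: real
  assumes "0 < \<alpha>" "\<alpha> < 1"
  shows "0 \<le> - (\<alpha> * ln \<alpha> + (1 - \<alpha>) * ln (1 - \<alpha>))"
proof -
  have "\<alpha> * ln \<alpha> \<le> 0" "(1 - \<alpha>) * ln (1 - \<alpha>) \<le> 0"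
    using assms by (simp_all add: mult_le_0_iff)
  then show ?thesis
    by simp
qed

text \<open>Gibbs' inequality against the uniform distribution: the slack terms
  \<open>1 / 2 - p\<close> for \<open>p = \<alpha>\<close> and \<open>p = 1 - \<alpha>\<close>
  cancel.\<close>

lemma binary_entropy_le_ln_2:
  fixes \<alpha> :: real
  assumes "0 < \<alpha>" "\<alpha> < 1"
  shows "- (\<alpha> * ln \<alpha> + (1 - \<alpha>) * ln (1 - \<alpha>)) \<le> ln 2"
proof -
  have *: "- (p * ln p) \<le> p * ln 2 + (1 / 2 - p)" if "0 < p" for p :: real
  proof -
    have "ln (1 / (2 * p)) \<le> 1 / (2 * p) - 1"
      using that by (intro ln_le_minus_one) simp
    then have "p * ln (1 / (2 * p)) \<le> p * (1 / (2 * p) - 1)"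
      using that by (intro mult_left_mono) simp_all
    then show ?thesis
      using that by (simp add: ln_div ln_mult algebra_simps)
  qed
  show ?thesis
    using *[of \<alpha>] *[of "1 - \<alpha>"] assms by (simp add: algebra_simps)
qed

text \<open>For \<open>\<alpha> \<ge> 1 / 2\<close> the bound \<open>ln 2\<close> suffices.
  Otherwise each entropy term is at most \<open>\<alpha> * ln k\<close>: the first since
  \<open>1 / \<alpha> \<le> k\<close>, the second since it is at most \<open>\<alpha>\<close> and
  \<open>ln k \<ge> 1\<close>.\<close>

lemma binary_entropy_le_mult_ln:
  fixes \<alpha> :: real and k :: nat
  assumes \<alpha>: "0 < \<alpha>" "\<alpha> < 1" and k: "2 \<le> k" "1 \<le> \<alpha> * real k"
  shows "- (\<alpha> * ln \<alpha> + (1 - \<alpha>) * ln (1 - \<alpha>)) \<le> 2 * \<alpha> * ln (real k)"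
proof (cases "1 / 2 \<le> \<alpha>")
  case True
  have "ln 2 \<le> ln (real k)"
    using k by simp
  also have "\<dots> \<le> 2 * \<alpha> * ln (real k)"
    using True k by (simp add: mult_le_cancel_right1)
  finally show ?thesis
    using binary_entropy_le_ln_2[OF \<alpha>] by simp
next
  case False
  \<comment> \<open>The estimate \<open>ln k \<ge> 1\<close> fails at \<open>k = 2\<close>, but
    \<open>\<alpha> < 1 / 2\<close> and \<open>\<alpha> * k \<ge> 1\<close> exclude that
    value.\<close>
  have "2 < k"
  proof (rule ccontr)
    assume "\<not> 2 < k"
    then show False
      using k False by simp
  qed
  then have "ln 3 \<le> ln (real k)"
    by simp
  then have ln_k: "1 \<le> ln (real k)"
    using ln3_gt_1 by simp
  have "ln (1 / \<alpha>) \<le> ln (real k)"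
    using \<alpha> k by (simp add: divide_le_eq mult.commute)
  then have 1: "- (\<alpha> * ln \<alpha>) \<le> \<alpha> * ln (real k)"
    using \<alpha> mult_left_mono[of "ln (1 / \<alpha>)" "ln (real k)" \<alpha>] by (simp add: ln_div)
  have "ln (1 / (1 - \<alpha>)) \<le> 1 / (1 - \<alpha>) - 1"
    using \<alpha> by (intro ln_le_minus_one) simp
  then have "(1 - \<alpha>) * ln (1 / (1 - \<alpha>)) \<le> (1 - \<alpha>) * (1 / (1 - \<alpha>) - 1)"
    using \<alpha> by (intro mult_left_mono) simp_all
  then have "- ((1 - \<alpha>) * ln (1 - \<alpha>)) \<le> \<alpha>"
    using \<alpha> by (simp add: ln_div right_diff_distrib)
  also have "\<dots> \<le> \<alpha> * ln (real k)"
    using \<alpha> ln_k by simp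
  finally show ?thesis
    using 1 by simp
qed

section \<open>The entropy bound on the Fourier dimension\<close>

lemma fourier_dim_le_entropy:
  fixes f :: "bit ^ 'n \<Rightarrow> real" and \<alpha> :: real
  assumes \<alpha>: "0 < \<alpha>" "\<alpha> < 1"
    and f: "\<And>x. f x \<in> {- 1, 1}"
    and f0: "fourier_coeff f 0 = 1 - 2 * \<alpha>"
  shows "real (fourier_dim f) * ln 2 \<le>
    real (card (fourier_support f)) * - (\<alpha> * ln \<alpha> + (1 - \<alpha>) * ln (1 - \<alpha>))"
proof -
  let ?N = "2 ^ CARD('n) :: real"
  let ?h = "\<alpha> * ln \<alpha> + (1 - \<alpha>) * ln (1 - \<alpha>)"
  define r where "r = fourier_dim f"
  have sum_f: "(\<Sum>x\<in>UNIV. f x) = (1 - 2 * \<alpha>) * ?N"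
    by (simp only: sum_eq_fourier_coeff_zero f0)
  have "finite (fourier_support f)"
    by simp
  from interpolation_set[OF this, where e = fourier_character]
  obtain Y where card_Y: "card Y \<le> card (fourier_support f)"
    and Y: "\<And>c x. \<forall>y\<in>Y. (\<Sum>S\<in>fourier_support f. c S * fourier_character S y) = 0 \<Longrightarrow>
      (\<Sum>S\<in>fourier_support f. c S * fourier_character S x) = 0"
    by blast
  \<comment> \<open>The pattern of the translate by \<open>x\<close> on \<open>Y\<close>, encoded as
    the set of points with value -1.\<close>
  define \<phi> where "\<phi> x = {y \<in> Y. f (x + y) = - 1}" for x
  obtain B where B: "B \<subseteq> fourier_support f" "vec.independent B" "card B = r"
    using vec.basis_exists[of "fourier_support f"] unfolding r_def fourier_dim_def
    by (metis vec.dim_span)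
  define K where "K = {z. \<forall>S\<in>B. fourier_character S z = 1}"
  have K: "real (card K) * 2 ^ r = ?N"
    using card_annihilator[OF B(2)] by (simp add: K_def B(3))

  \<comment> \<open>The difference of two translates is a combination of characters from the
    support; if it vanishes on \<open>Y\<close>, it vanishes everywhere. In characteristic 2,
    \<open>x + x'\<close> is the difference of \<open>x\<close> and \<open>x'\<close>.\<close>
  have \<phi>_eq: "x + x' \<in> K" if "\<phi> x = \<phi> x'" for x x'
  proof -
    have eq: "f (x + y) - f (x' + y) = (\<Sum>S\<in>fourier_support f. (fourier_coeff f S *
        (fourier_character S x - fourier_character S x')) * fourier_character S y)" for y
      by (simp add: fourier_inversion[of f "_ + _"] fourier_character_add_right
          sum_subtractf[symmetric] algebra_simps)
    have "f (x + y) = f (x' + y)" if "y \<in> Y" for y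
    proof -
      have "y \<in> \<phi> x \<longleftrightarrow> y \<in> \<phi> x'"
        using \<open>\<phi> x = \<phi> x'\<close> by simp
      then show ?thesis
        using that f[of "x + y"] f[of "x' + y"] by (auto simp: \<phi>_def)
    qed
    then have "\<forall>y\<in>Y. (\<Sum>S\<in>fourier_support f. (fourier_coeff f S *
        (fourier_character S x - fourier_character S x')) * fourier_character S y) = 0"
      unfolding eq[symmetric] by simp
    from Y[OF this] have "f (x + y) = f (x' + y)" for y
      unfolding eq[symmetric] by simp
    then have "fourier_character S x = fourier_character S x'" if "S \<in> B" for S
      using that B(1) by (intro fourier_character_eq_if_translates_eq[of f]) auto
    moreover have "fourier_character S x' * fourier_character S x' = 1" for S
      using fourier_character_cases[of S x'] by auto
    ultimately show ?thesis
      by (simp add: K_def fourier_character_add_right)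
  qed
  have fibre: "card {x. \<phi> x = A} \<le> card K" for A
  proof (cases "\<exists>x. \<phi> x = A")
    case True
    then obtain x' where x': "\<phi> x' = A"
      by blast
    have "(\<lambda>x. x + x') ` {x. \<phi> x = A} \<subseteq> K"
      using \<phi>_eq x' by auto
    then show ?thesis
      by (intro card_inj_on_le[of "\<lambda>x. x + x'"]) (auto simp: inj_on_def)
  qed simp

  \<comment> \<open>Subadditivity of entropy as Gibbs' inequality against the product Bernoulli measure \<open>w\<close>.\<close>
  define w where "w A = \<alpha> ^ card A * (1 - \<alpha>) ^ card (Y - A)" for A
  have w_pos: "0 < w A" for A
    using \<alpha> by (simp add: w_def)
  have "(\<Prod>y\<in>Y. \<alpha> + (1 - \<alpha>)) = (\<Sum>A\<in>Pow Y. w A)"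
    by (simp only: prod_add[OF finite] prod_constant w_def)
  then have sum_w: "(\<Sum>A\<in>Pow Y. w A) = 1"
    by simp
  have "(\<Sum>x\<in>UNIV. w (\<phi> x)) = (\<Sum>A\<in>Pow Y. \<Sum>x | x \<in> UNIV \<and> \<phi> x = A. w (\<phi> x))"
    by (rule sum.group[symmetric]) (auto simp: \<phi>_def)
  also have "\<dots> = (\<Sum>A\<in>Pow Y. real (card {x. \<phi> x = A}) * w A)"
    by simp
  also have "\<dots> \<le> (\<Sum>A\<in>Pow Y. real (card K) * w A)"
    using fibre w_pos by (intro sum_mono mult_right_mono) (auto intro: less_imp_le)
  also have "\<dots> = real (card K)"
    by (simp add: sum_distrib_left[symmetric] sum_w)
  finally have "(\<Sum>x\<in>UNIV. w (\<phi> x)) * 2 ^ r \<le> ?N"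
    using K by (metis mult_right_mono zero_le_numeral zero_le_power)
  \<comment> \<open>This is \<open>ln t \<le> t - 1\<close> at
    \<open>t = w (\<phi> x) * 2 ^ r\<close>, whose mean over the cube is at most 1 by the fibre
    bound; hence the left side is at most 0.\<close>
  moreover have "(\<Sum>x\<in>UNIV. ln (w (\<phi> x)) + real r * ln 2) \<le> (\<Sum>x\<in>UNIV. w (\<phi> x) * 2 ^ r - 1)"
  proof (rule sum_mono)
    fix x
    have "ln (w (\<phi> x) * 2 ^ r) \<le> w (\<phi> x) * 2 ^ r - 1"
      using w_pos by (intro ln_le_minus_one) simp
    then show "ln (w (\<phi> x)) + real r * ln 2 \<le> w (\<phi> x) * 2 ^ r - 1"
      using w_pos[of "\<phi> x"] by (simp add: ln_mult ln_realpow)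
  qed
  ultimately have "(\<Sum>x\<in>UNIV. ln (w (\<phi> x))) + ?N * (real r * ln 2) \<le> 0"
    unfolding sum.distrib sum_subtractf sum_distrib_right[symmetric] sum_constant real_card_cube
    by (simp add: mult.assoc)

  moreover have "(\<Sum>x\<in>UNIV. ln (w (\<phi> x))) = ?N * (real (card Y) * ?h)"
  proof -
    have ln_w: "ln (w (\<phi> x)) = (\<Sum>y\<in>Y. if f (x + y) = - 1 then ln \<alpha> else ln (1 - \<alpha>))" for x
    proof -
      have "Y - \<phi> x = {y \<in> Y. f (x + y) \<noteq> - 1}"
        by (auto simp: \<phi>_def)
      then show ?thesis
        using \<alpha> by (simp add: w_def ln_mult ln_realpow sum.If_cases \<phi>_def Int_def)
    qed
    have "(\<Sum>x\<in>UNIV. if f (x + y) = - 1 then ln \<alpha> else ln (1 - \<alpha>)) = ?N * ?h" for y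
    proof -
      have "(\<Sum>x\<in>UNIV. if f (x + y) = - 1 then ln \<alpha> else ln (1 - \<alpha>)) =
          (\<Sum>x\<in>UNIV. if f x = - 1 then ln \<alpha> else ln (1 - \<alpha>))"
        by (rule sum_translate)
      \<comment> \<open>On the values -1 and 1 the case distinction is affine in \<open>f x\<close>,
        so the sum depends only on the mean of \<open>f\<close>.\<close>
      also have "\<dots> = (\<Sum>x\<in>UNIV. (ln \<alpha> + ln (1 - \<alpha>)) / 2 + f x * ((ln (1 - \<alpha>) - ln \<alpha>) / 2))"
      proof (intro sum.cong refl)
        fix x
        show "(if f x = - 1 then ln \<alpha> else ln (1 - \<alpha>)) =
            (ln \<alpha> + ln (1 - \<alpha>)) / 2 + f x * ((ln (1 - \<alpha>) - ln \<alpha>) / 2)"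
          using f[of x] by (auto simp: field_simps)
      qed
      also have "\<dots> = ?N * ((ln \<alpha> + ln (1 - \<alpha>)) / 2) +
          (\<Sum>x\<in>UNIV. f x) * ((ln (1 - \<alpha>) - ln \<alpha>) / 2)"
        by (simp only: sum.distrib sum_distrib_right sum_constant real_card_cube)
      also have "\<dots> = ?N * ?h"
        unfolding sum_f by (simp add: field_simps)
      finally show ?thesis .
    qed
    then show ?thesis
      unfolding ln_w by (subst sum.swap) simp
  qed
  ultimately have "?N * (real (card Y) * ?h + real r * ln 2) \<le> 0"
    by (simp only: distrib_left)
  then have "real (card Y) * ?h + real r * ln 2 \<le> 0"
    by (simp add: mult_le_0_iff power_le_zero_eq)
  then have "real r * ln 2 \<le> real (card Y) * - ?h"
    by (simp only: mult_minus_right)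
  also have "\<dots> \<le> real (card (fourier_support f)) * - ?h"
    using card_Y binary_entropy_nonneg[OF \<alpha>] by (intro mult_right_mono) simp_all
  finally show ?thesis
    by (simp add: r_def)
qed

section \<open>The uncertainty bound\<close>

text \<open>At a point where \<open>f\<close> is -1, the nonzero frequencies must bring the constant
  term \<open>1 - 2 * \<alpha>\<close> down to -1, and each contributes at most
  \<open>2 * \<alpha>\<close> in absolute value.\<close>

lemma one_le_bias_mult_sparsity:
  fixes f :: "bit ^ 'n \<Rightarrow> real"
  assumes \<alpha>: "0 < \<alpha>" "\<alpha> < 1 / 2"
    and f: "\<And>x. f x \<in> {- 1, 1}"
    and f0: "fourier_coeff f 0 = 1 - 2 * \<alpha>"
  shows "1 \<le> \<alpha> * real (card (fourier_support f))"
proof -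
  let ?N = "2 ^ CARD('n) :: real"
  let ?F = "fourier_support f"
  have sum_f: "(\<Sum>x\<in>UNIV. f x) = (1 - 2 * \<alpha>) * ?N"
    by (simp only: sum_eq_fourier_coeff_zero f0)
  have coeff: "\<bar>fourier_coeff f S\<bar> \<le> 2 * \<alpha>" if "S \<noteq> 0" for S
  proof -
    \<comment> \<open>A nontrivial character sums to 0, so \<open>f\<close> may be replaced by
      \<open>1 - f\<close>, which is nonnegative with mean \<open>2 * \<alpha>\<close>.\<close>
    have "(\<Sum>x\<in>UNIV. f x * fourier_character S x) = - (\<Sum>x\<in>UNIV. (1 - f x) * fourier_character S x)"
      using that by (simp add: algebra_simps sum_subtractf sum_fourier_character)
    also have "\<bar>\<dots>\<bar> \<le> (\<Sum>x\<in>UNIV. \<bar>(1 - f x) * fourier_character S x\<bar>)"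
      by (simp only: abs_minus_cancel sum_abs)
    also have "\<dots> = (\<Sum>x\<in>UNIV. 1 - f x)"
    proof (intro sum.cong refl)
      fix x
      show "\<bar>(1 - f x) * fourier_character S x\<bar> = 1 - f x"
        using f[of x] by (auto simp: fourier_character_def)
    qed
    also have "\<dots> = 2 * \<alpha> * ?N"
      by (simp only: sum_subtractf sum_constant real_card_cube sum_f) (simp add: algebra_simps)
    finally show ?thesis
      by (simp add: fourier_coeff_def abs_divide divide_le_eq)
  qed
  have "\<exists>x. f x \<noteq> 1"
  proof (rule ccontr)
    assume "\<nexists>x. f x \<noteq> 1"
    then have "(\<Sum>x\<in>UNIV. f x) = ?N"
      using real_card_cube[where 'n = 'n] by simp
    with sum_f \<alpha> show False
      by (simp add: field_simps)
  qed
  then obtain x where x: "f x = - 1"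
    using f by blast
  have 0: "0 \<in> ?F"
    using \<alpha> f0 by (simp add: fourier_support_def)
  have "f x = (1 - 2 * \<alpha>) + (\<Sum>S\<in>?F - {0}. fourier_coeff f S * fourier_character S x)"
    unfolding fourier_inversion[of f x] by (subst sum.remove[OF _ 0]) (simp_all add: f0)
  moreover have "(\<Sum>S\<in>?F - {0}. - 2 * \<alpha>) \<le>
      (\<Sum>S\<in>?F - {0}. fourier_coeff f S * fourier_character S x)"
  proof (rule sum_mono)
    fix S assume "S \<in> ?F - {0}"
    then show "- 2 * \<alpha> \<le> fourier_coeff f S * fourier_character S x"
      using coeff[of S] by (auto simp: fourier_character_def abs_le_iff)
  qed
  moreover have "(\<Sum>S\<in>?F - {0}. - 2 * \<alpha>) = - 2 * \<alpha> * (real (card ?F) - 1)"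
  proof -
    have "1 \<le> card ?F"
      using 0 by (simp add: Suc_le_eq card_gt_0_iff) blast
    then show ?thesis
      using 0 by (simp add: card_Diff_singleton of_nat_diff)
  qed
  ultimately have "1 - 2 * \<alpha> - 2 * \<alpha> * (real (card ?F) - 1) \<le> - 1"
    using x by linarith
  then show ?thesis
    by (simp add: algebra_simps)
qed

theorem theorem9:
  fixes f :: "bit ^ 'n \<Rightarrow> real" and \<alpha> :: real and k r :: nat
  assumes "0 < \<alpha>" and "\<alpha> < 1"
    and "2 \<le> k"
    and "\<And>x. f x \<in> {- 1, 1}"
    and "fourier_sparse k f"
    and "fourier_coeff f 0 = 1 - 2 * \<alpha>"
    and "fourier_dim f = r"
  shows "fourier_coeff f 0 \<le> 1 - real r / (real k * log 2 (real k))"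
proof -
  let ?h = "- (\<alpha> * ln \<alpha> + (1 - \<alpha>) * ln (1 - \<alpha>))"
  have card: "card (fourier_support f) \<le> k"
    using assms(5) by (simp add: fourier_sparse_def)
  \<comment> \<open>The uncertainty bound covers \<open>\<alpha> < 1 / 2\<close>; for larger
    \<open>\<alpha>\<close> the claim is immediate from \<open>k \<ge> 2\<close>.\<close>
  have "1 \<le> \<alpha> * real k"
  proof (cases "\<alpha> < 1 / 2")
    case True
    have "1 \<le> \<alpha> * real (card (fourier_support f))"
      using one_le_bias_mult_sparsity[OF assms(1) True] assms(4,6) by blast
    also have "\<dots> \<le> \<alpha> * real k"
      using assms(1) card by simp
    finally show ?thesis .
  next
    case False
    then show ?thesis
      using assms(3) mult_mono[of "1 / 2" \<alpha> 2 "real k"] by simp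
  qed
  then have h: "?h \<le> 2 * \<alpha> * ln (real k)"
    by (rule binary_entropy_le_mult_ln[OF assms(1-3)])
  have "real r * ln 2 \<le> real (card (fourier_support f)) * ?h"
    using fourier_dim_le_entropy[OF assms(1,2) _ assms(6)] assms(4,7) by blast
  also have "\<dots> \<le> real k * ?h"
    using card binary_entropy_nonneg[OF assms(1,2)] by (intro mult_right_mono) simp_all
  also have "\<dots> \<le> real k * (2 * \<alpha> * ln (real k))"
    using h by (intro mult_left_mono) simp_all
  finally have "real r \<le> 2 * \<alpha> * (real k * log 2 (real k))"
    by (simp add: log_def field_simps)
  moreover have "0 < real k * log 2 (real k)"
    using assms(3) by simp
  ultimately have "real r / (real k * log 2 (real k)) \<le> 2 * \<alpha>"
    by (simp only: divide_le_eq if_True)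
  then show ?thesis
    using assms(6) by simp
qed

end
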